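(* Let $d\ge 2$ be a natural number and let $\varepsilon\in(0,1/2)$. Then there exists a finite point set $\mathcal{P}\subset[0,1]^d$ with $\operatorname{disp}(\mathcal{P})\le\varepsilon$ and \[ \#\mathcal{P} \;\le\; 2^7\,\log_2(d)\,\frac{\bigl(1+\log_2(\varepsilon^{-1})\bigr)^2}{\varepsilon^{2}}. \]
   Context: For $d\in\mathbb{N}$ and a finite point set $\mathcal{P}\subset[0,1]^d$, the dispersion of $\mathcal{P}$ is \[ \operatorname{disp}(\mathcal{P}) := \sup_{B\colon B\cap\mathcal{P}=\varnothing} |B|, \] where the supremum is over all axis-parallel boxes $B=I_1\times\dots\times I_d$ with intervals $I_\ell\subset[0,1]$ such that $B\cap\mathcal{P}=\varnothing$, and $|B|$ denotes the Lebesgue volume of $B$. $\#\mathcal{P}$ denotes the cardinality of $\mathcal{P}$. *)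

theory Defs
  imports "HOL-Analysis.Analysis"
begin

definition unit_cube :: "(real ^ 'd) set" where
  "unit_cube = {x. \<forall>i. x $ i \<in> {0..1}}"

(* The side intervals may be open, closed, half-open, degenerate or empty. *)
definition unit_box :: "(real ^ 'd) set \<Rightarrow> bool" where
  "unit_box B \<longleftrightarrow>
     (\<exists>I :: 'd \<Rightarrow> real set. (\<forall>i. is_interval (I i) \<and> I i \<subseteq> {0..1}) \<and> B = {x. \<forall>i. x $ i \<in> I i})"

(* The supremum is a genuine one: the empty box is always admissible, and all
   volumes are at most 1. *)
definition disp :: "(real ^ 'd) set \<Rightarrow> real" where
  "disp P = (SUP B \<in> {B. unit_box B \<and> B \<inter> P = {}}. measure lebesgue B)"

end

theory Submission
  imports Defs
begin

text \<open>With \<open>R = \<lceil>2/\<epsilon>\<rceil>\<close>, take the grid of points with coordinates \<open>j/(R + 1)\<close>, \<open>1 \<le> j \<le> R\<close>. A box with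
  side lengths \<open>w\<^sub>i\<close> and volume greater than \<open>\<epsilon>\<close> contains a proportion of at least
  \<open>\<Prod>\<^sub>i ((R + 1) w\<^sub>i - 1)/R \<ge> \<epsilon>/2\<close> of the grid, and its trace on the grid is a proper restriction in at most
  \<open>A = \<lfloor>(R + 1) ln (1/\<epsilon>)\<rfloor>\<close> coordinates, because \<open>w\<^sub>i \<le> 1 - 1/(R + 1)\<close> in each of these. Hence there
  are at most \<open>(d R\<^sup>2)\<^sup>A\<close> traces, and choosing grid points greedily hits all of them as soon as
  the number of chosen points exceeds \<open>(2/\<epsilon>) A ln (d R\<^sup>2)\<close>.\<close>

section \<open>Greedy choice of hitting sets\<close>

text \<open>Double counting the incidences between points and sets not yet hit shows that some point
  of \<open>X\<close> lies in at least a fraction \<open>p\<close> of these sets. Adding it to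
  \<open>Q\<close> leaves at most a fraction \<open>1 - p\<close> of them unhit.\<close>

lemma greedy_hitting_set:
  fixes p :: real
  assumes "finite X" and "finite F" and "X \<noteq> {}" and "p \<le> 1"
    and sub: "\<And>S. S \<in> F \<Longrightarrow> S \<subseteq> X"
    and dense: "\<And>S. S \<in> F \<Longrightarrow> p * real (card X) \<le> real (card S)"
  shows "\<exists>Q\<subseteq>X. card Q \<le> n \<and> real (card {S\<in>F. S \<inter> Q = {}}) \<le> (1 - p) ^ n * real (card F)"
proof (induction n)
  case 0
  show ?case by (rule exI[of _ "{}"]) simp
next
  case (Suc n)
  then obtain Q where Q: "Q \<subseteq> X" "card Q \<le> n"
    "real (card {S\<in>F. S \<inter> Q = {}}) \<le> (1 - p) ^ n * real (card F)" by blast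
  define G where "G = {S\<in>F. S \<inter> Q = {}}"
  have finG: "finite G" using \<open>finite F\<close> by (simp add: G_def)
  have "\<exists>x\<in>X. p * real (card G) \<le> real (card {S\<in>G. x \<in> S})"
  proof (rule ccontr)
    assume "\<not> ?thesis"
    then have "(\<Sum>x\<in>X. real (card {S\<in>G. x \<in> S})) < (\<Sum>x\<in>X. p * real (card G))"
      using \<open>finite X\<close> \<open>X \<noteq> {}\<close> by (intro sum_strict_mono) auto
    also have "\<dots> = (\<Sum>S\<in>G. p * real (card X))" by simp
    also have "\<dots> \<le> (\<Sum>S\<in>G. real (card S))"
      by (intro sum_mono dense) (auto simp: G_def)
    also have "\<dots> = (\<Sum>S\<in>G. \<Sum>x\<in>X. if x \<in> S then 1 else 0)"
    proof (rule sum.cong[OF refl])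
      fix S assume "S \<in> G"
      then have "X \<inter> S = S" using sub by (auto simp: G_def)
      then show "real (card S) = (\<Sum>x\<in>X. if x \<in> S then 1 else 0)"
        using \<open>finite X\<close> by (simp flip: sum.inter_restrict)
    qed
    also have "\<dots> = (\<Sum>x\<in>X. \<Sum>S\<in>G. if x \<in> S then 1 else 0)" by (rule sum.swap)
    also have "\<dots> = (\<Sum>x\<in>X. real (card {S\<in>G. x \<in> S}))"
      using finG by (simp flip: sum.inter_filter)
    finally show False by simp
  qed
  then obtain x where x: "x \<in> X" "p * real (card G) \<le> real (card {S\<in>G. x \<in> S})" by blast
  have "{S\<in>F. S \<inter> insert x Q = {}} = G - {S\<in>G. x \<in> S}" by (auto simp: G_def)
  then have "real (card {S\<in>F. S \<inter> insert x Q = {}}) = real (card G) - real (card {S\<in>G. x \<in> S})"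
    using finG by (simp add: card_Diff_subset card_mono of_nat_diff)
  also have "\<dots> \<le> (1 - p) * real (card G)" using x by (simp add: algebra_simps)
  also have "\<dots> \<le> (1 - p) * ((1 - p) ^ n * real (card F))"
    using Q \<open>p \<le> 1\<close> by (intro mult_left_mono) (auto simp: G_def)
  finally have "real (card {S\<in>F. S \<inter> insert x Q = {}}) \<le> (1 - p) ^ Suc n * real (card F)"
    by (simp add: mult.assoc)
  moreover have "card (insert x Q) \<le> Suc n"
    using card_insert_le_m1[of "Suc n" Q x] Q by simp
  ultimately show ?case using Q x by (intro exI[of _ "insert x Q"]) auto
qed

text \<open>Since \<open>1 - p \<le> exp (- p)\<close>, fewer than one set remains unhit after
  \<open>n\<close> greedy choices, and a cardinality below 1 is 0.\<close>

corollary hitting_set: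
  fixes p :: real
  assumes "finite X" and "finite F" and "X \<noteq> {}" and "p \<le> 1"
    and sub: "\<And>S. S \<in> F \<Longrightarrow> S \<subseteq> X"
    and dense: "\<And>S. S \<in> F \<Longrightarrow> p * real (card X) \<le> real (card S)"
    and n: "real (card F) < exp (p * real n)"
  shows "\<exists>Q\<subseteq>X. card Q \<le> n \<and> (\<forall>S\<in>F. S \<inter> Q \<noteq> {})"
proof -
  obtain Q where Q: "Q \<subseteq> X" "card Q \<le> n"
    "real (card {S\<in>F. S \<inter> Q = {}}) \<le> (1 - p) ^ n * real (card F)"
    using greedy_hitting_set[OF assms(1-6)] by blast
  have "(1 - p) ^ n \<le> exp (- p) ^ n"
    using \<open>p \<le> 1\<close> exp_ge_add_one_self[of "- p"] by (intro power_mono) auto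
  also have "\<dots> = exp (- (p * real n))" by (simp flip: exp_of_nat_mult add: mult.commute)
  finally have "(1 - p) ^ n * real (card F) \<le> exp (- (p * real n)) * real (card F)"
    by (rule mult_right_mono) simp
  also have "\<dots> < exp (- (p * real n)) * exp (p * real n)" using n by simp
  also have "\<dots> = 1" by (simp flip: exp_add)
  finally have "card {S\<in>F. S \<inter> Q = {}} = 0" using Q(3) by linarith
  then have "{S\<in>F. S \<inter> Q = {}} = {}" using \<open>finite F\<close> by simp
  then show ?thesis using Q by blast
qed

section \<open>From volume to proportion of the grid\<close>

text \<open>For \<open>\<delta> = 1 / R\<close> the map g(t) =
  \<open>(1 + \<delta>) * t - \<delta>\<close> equals \<open>((R + 1) * t - 1) / R\<close>, the
  guaranteed proportion of grid coordinates in an interval of length t. The induction rests on g(s)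
  g(t) \<ge> g(s t) for s, t \<le> 1; the last hypothesis makes all factors nonnegative.\<close>

lemma prod_affine_ge:
  fixes x :: "'a \<Rightarrow> real"
  assumes "finite I" and "\<delta> \<ge> 0" and "\<And>i. i \<in> I \<Longrightarrow> x i \<le> 1"
    and "\<And>i. i \<in> I \<Longrightarrow> \<delta> \<le> (1 + \<delta>) * x i"
  shows "(1 + \<delta>) * (\<Prod>i\<in>I. x i) - \<delta> \<le> (\<Prod>i\<in>I. (1 + \<delta>) * x i - \<delta>)"
  using assms
proof (induction I rule: finite_induct)
  case (insert j I)
  define y where "y = (\<Prod>i\<in>I. x i)"
  have x0: "0 \<le> x i" if "i \<in> insert j I" for i
  proof -
    have "0 \<le> (1 + \<delta>) * x i" using insert.prems(3)[OF that] \<open>\<delta> \<ge> 0\<close> by linarith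
    then show ?thesis using \<open>\<delta> \<ge> 0\<close> by (simp add: zero_le_mult_iff)
  qed
  have "y \<le> 1" unfolding y_def using insert.prems x0 by (intro prod_le_1) auto
  \<comment> \<open>The right-hand side is exactly g(\<open>x j\<close>) g(\<open>y\<close>) -
    g(\<open>x j * y\<close>) for g(t) = \<open>(1 + \<delta>) * t - \<delta>\<close>.\<close>
  then have "0 \<le> \<delta> * (1 + \<delta>) * (1 - x j) * (1 - y)"
    using insert.prems by auto
  then have "(1 + \<delta>) * (x j * y) - \<delta> \<le> ((1 + \<delta>) * x j - \<delta>) * ((1 + \<delta>) * y - \<delta>)"
    by (simp add: algebra_simps)
  also have "\<dots> \<le> ((1 + \<delta>) * x j - \<delta>) * (\<Prod>i\<in>I. (1 + \<delta>) * x i - \<delta>)"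
    using insert unfolding y_def by (intro mult_left_mono) auto
  finally show ?case using insert.hyps by (simp add: y_def)
qed simp

section \<open>Boxes in the grid and their number\<close>

text \<open>Grid points are represented by their integer index vectors, so that counting stays in
  the natural numbers; division by \<open>R + 1\<close> is applied only when real points are
  needed.\<close>

definition index_box :: "('d \<Rightarrow> nat) \<Rightarrow> ('d \<Rightarrow> nat) \<Rightarrow> ('d \<Rightarrow> nat) set" where
  "index_box a b = (\<Pi>\<^sub>E i\<in>UNIV. {a i..b i})"

text \<open>A side with \<open>a i = 1\<close> and \<open>b i = R\<close> restricts nothing, so at
  most \<open>A\<close> sides carry information. This keeps the dimension in the base
  \<open>d * R * R\<close> of the count and out of its exponent.\<close>

definition sparse_boxes :: "nat \<Rightarrow> nat \<Rightarrow> ('d::finite \<Rightarrow> nat) set set" where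
  "sparse_boxes R A = {index_box a b | a b.
     (\<forall>i. a i \<in> {1..R} \<and> b i \<in> {1..R}) \<and> card {i. a i \<noteq> 1 \<or> b i \<noteq> R} \<le> A}"

lemma mem_index_box: "f \<in> index_box a b \<longleftrightarrow> (\<forall>i. a i \<le> f i \<and> f i \<le> b i)"
  by (auto simp: index_box_def PiE_UNIV_domain)

lemma card_index_box: "card (index_box a b :: ('d::finite \<Rightarrow> nat) set) = (\<Prod>i\<in>UNIV. Suc (b i) - a i)"
  by (simp add: index_box_def card_PiE)

lemma sparse_box_subset:
  assumes "S \<in> sparse_boxes R A"
  shows "S \<subseteq> index_box (\<lambda>_. 1) (\<lambda>_. R)"
proof -
  obtain a b where S: "S = index_box a b" and ab: "\<forall>i. a i \<in> {1..R} \<and> b i \<in> {1..R}"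
    using assms unfolding sparse_boxes_def by blast
  have "{a i..b i} \<subseteq> {1..R}" for i using ab[rule_format, of i] by auto
  then show ?thesis unfolding S index_box_def by (intro PiE_mono)
qed

text \<open>A sparse box is encoded by a list of exactly \<open>A\<close> side constraints that includes all the
  non-trivial ones; the list is padded with a repeated constraint.\<close>

lemma sparse_boxes_bound:
  shows "finite (sparse_boxes R A :: ('d::finite \<Rightarrow> nat) set set)"
    and "card (sparse_boxes R A :: ('d \<Rightarrow> nat) set set) \<le> (CARD('d) * (R * R)) ^ A"
proof -
  define C where "C = (UNIV :: 'd set) \<times> ({1..R} \<times> {1..R})"
  \<comment> \<open>The range condition supplies the full side \<open>{1..R}\<close> for each
    coordinate that the list does not mention.\<close>
  define dec where "dec xs = {f :: 'd \<Rightarrow> nat. (\<forall>i. f i \<in> {1..R}) \<and>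
      (\<forall>(i, l, u)\<in>set xs. l \<le> f i \<and> f i \<le> u)}" for xs :: "('d \<times> nat \<times> nat) list"
  have finC: "finite C" by (simp add: C_def)
  have sub: "sparse_boxes R A \<subseteq> dec ` {xs. set xs \<subseteq> C \<and> length xs = A}"
  proof
    fix S :: "('d \<Rightarrow> nat) set"
    assume "S \<in> sparse_boxes R A"
    then obtain a b where ab: "S = index_box a b" "\<And>i. a i \<in> {1..R}" "\<And>i. b i \<in> {1..R}"
      "card {i. a i \<noteq> 1 \<or> b i \<noteq> R} \<le> A"
      by (auto simp: sparse_boxes_def)
    define T where "T = {i. a i \<noteq> 1 \<or> b i \<noteq> R}"
    obtain ys where ys: "set ys = T" "length ys = card T"
      using finite_distinct_list[of T] distinct_card by (metis finite)
    \<comment> \<open>Any fixed coordinate can serve as padding: its entry in \<open>xs\<close> is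
      the box's own side there, which every member of the box satisfies.\<close>
    define zs where "zs = ys @ replicate (A - card T) undefined"
    define xs where "xs = map (\<lambda>i. (i, a i, b i)) zs"
    have "length xs = A" using ab(4)[folded T_def] ys by (simp add: xs_def zs_def)
    moreover have "set xs \<subseteq> C" using ab(2,3) by (auto simp: xs_def C_def)
    moreover have "S = dec xs"
    proof (intro set_eqI iffI)
      fix f assume "f \<in> S"
      then have f: "a i \<le> f i \<and> f i \<le> b i" for i by (simp add: ab(1) mem_index_box)
      have "f i \<in> {1..R}" for i using f[of i] ab(2)[of i] ab(3)[of i] by auto
      with f show "f \<in> dec xs" by (auto simp: dec_def xs_def)
    next
      fix f assume f: "f \<in> dec xs"
      have "a i \<le> f i \<and> f i \<le> b i" for i
      proof (cases "i \<in> T")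
        case True
        then have "(i, a i, b i) \<in> set xs" using ys by (auto simp: xs_def zs_def)
        then show ?thesis using f by (auto simp: dec_def)
      next
        case False
        then show ?thesis using f by (auto simp: dec_def T_def)
      qed
      then show "f \<in> S" by (simp add: ab(1) mem_index_box)
    qed
    ultimately show "S \<in> dec ` {xs. set xs \<subseteq> C \<and> length xs = A}" by blast
  qed
  have fin: "finite {xs. set xs \<subseteq> C \<and> length xs = A}" using finC by (rule finite_lists_length_eq)
  show "finite (sparse_boxes R A :: ('d \<Rightarrow> nat) set set)" using finite_surj[OF fin sub] .
  have "card (sparse_boxes R A :: ('d \<Rightarrow> nat) set set) \<le> card {xs. set xs \<subseteq> C \<and> length xs = A}"
    using surj_card_le[OF fin sub] .
  then show "card (sparse_boxes R A :: ('d \<Rightarrow> nat) set set) \<le> (CARD('d) * (R * R)) ^ A"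
    by (simp add: card_lists_length_eq[OF finC]) (simp add: C_def card_cartesian_product)
qed

section \<open>Boxes in the cube and the grid boxes inside them\<close>

lemma measure_box_le:
  fixes I :: "'d::finite \<Rightarrow> real set"
  assumes "\<And>i. I i \<noteq> {}" and "\<And>i. I i \<subseteq> {0..1}"
  shows "measure lebesgue {x. \<forall>i. x $ i \<in> I i} \<le> (\<Prod>i\<in>UNIV. Sup (I i) - Inf (I i))"
proof -
  let ?B = "{x. \<forall>i. x $ i \<in> I i}"
  let ?C = "cbox (\<chi> i. Inf (I i)) (\<chi> i. Sup (I i))"
  have bdd: "bdd_below (I i)" "bdd_above (I i)" for i
    using assms(2)[of i] by (meson bdd_below_Icc bdd_below_mono, meson bdd_above_Icc bdd_above_mono)
  have le: "Inf (I i) \<le> y \<and> y \<le> Sup (I i)" if "y \<in> I i" for i y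
    using that bdd by (auto intro: cInf_lower cSup_upper)
  have "Inf (I i) \<le> Sup (I i)" for i using assms(1)[of i] le by fastforce
  then have C: "measure lebesgue ?C = (\<Prod>i\<in>UNIV. Sup (I i) - Inf (I i))"
    by (subst measure_completion, simp, subst content_cbox_cart) (auto simp: interval_ne_empty_cart)
  have "measure lebesgue ?B \<le> measure lebesgue ?C"
  proof (cases "?B \<in> sets lebesgue")
    case True
    then show ?thesis using le by (intro measure_mono_fmeasurable) (auto simp: mem_box_cart)
  next
    \<comment> \<open>\<open>measure\<close> is 0 outside the sigma-algebra, so the bound holds
      without proving \<open>?B\<close> measurable.\<close>
    case False
    then show ?thesis by (simp add: measure_notin_sets)
  qed
  with C show ?thesis by simp
qed

text \<open>The indices strictly between \<open>l * (R + 1)\<close> and \<open>u * (R + 1)\<close>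
  form a block \<open>{a..b}\<close>. If it misses the index 1 or \<open>R\<close>, then the
  interval has lost a piece of length at least \<open>1 / (R + 1)\<close> at that end of the unit
  interval.\<close>

lemma grid_interval:
  fixes l u :: real and R :: nat
  assumes "0 \<le> l" and "u \<le> 1" and "1 < (real R + 1) * (u - l)"
  obtains a b where "a \<in> {1..R}" and "b \<in> {1..R}"
    and "\<And>j. j \<in> {a..b} \<Longrightarrow> l < real j / (real R + 1) \<and> real j / (real R + 1) < u"
    and "(real R + 1) * (u - l) - 1 \<le> real (Suc b - a)"
    and "a \<noteq> 1 \<or> b \<noteq> R \<Longrightarrow> u - l \<le> 1 - 1 / (real R + 1)"
proof -
  define N where "N = real R + 1"
  have N: "N > 0" by (simp add: N_def)
  \<comment> \<open>Floor plus one and ceiling minus one exclude endpoints that are themselves grid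
    coordinates, as open sides require.\<close>
  define a where "a = nat \<lfloor>l * N\<rfloor> + 1"
  define b where "b = nat (\<lceil>u * N\<rceil> - 1)"
  have "0 \<le> l * N" using assms N by simp
  then have a: "real a = real_of_int \<lfloor>l * N\<rfloor> + 1" by (simp add: a_def)
  have uN: "1 + l * N < u * N" using assms(3) by (simp add: N_def algebra_simps)
  then have "1 < u * N" using \<open>0 \<le> l * N\<close> by linarith
  then have b: "real b = real_of_int \<lceil>u * N\<rceil> - 1" by (simp add: b_def)
  have len: "N * (u - l) - 1 \<le> real b + 1 - real a"
    unfolding a b by (simp add: algebra_simps) linarith
  then have "real a < real b + 1" using assms(3) by (simp add: N_def)
  then have ab: "a \<le> b" by simp
  have "u * N \<le> real R + 1" using assms(2) N mult_right_mono[of u 1 N] by (simp add: N_def)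
  then have "\<lceil>u * N\<rceil> \<le> int R + 1" by (simp add: ceiling_le_iff)
  then have bR: "b \<le> R" by (simp add: b_def)
  have a1: "1 \<le> a" by (simp add: a_def)
  show ?thesis
  proof (rule that[of a b])
    show "a \<in> {1..R}" "b \<in> {1..R}" using ab bR a1 by auto
    show "(real R + 1) * (u - l) - 1 \<le> real (Suc b - a)"
      using len ab by (simp add: N_def of_nat_diff)
  next
    fix j assume j: "j \<in> {a..b}"
    then have "real a \<le> real j" "real j \<le> real b" by auto
    then have "l * N < real j" "real j < u * N" unfolding a b by linarith+
    then show "l < real j / (real R + 1) \<and> real j / (real R + 1) < u"
      using N by (simp add: N_def pos_less_divide_eq pos_divide_less_eq)
  next
    assume "a \<noteq> 1 \<or> b \<noteq> R"
    then have "1 \<le> l * N \<or> u * N \<le> N - 1"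
    proof
      assume "a \<noteq> 1"
      then have "2 \<le> real a" using a1 by linarith
      then show ?thesis unfolding a by linarith
    next
      assume "b \<noteq> R"
      then have "real b + 1 \<le> real R" using bR by linarith
      then show ?thesis unfolding b N_def by linarith
    qed
    moreover have "u * N \<le> N" "0 \<le> l * N" using assms N by simp_all
    ultimately have "(u - l) * N \<le> N - 1" by (auto simp: algebra_simps)
    then have "u - l \<le> (N - 1) / N" using N by (simp add: pos_le_divide_eq)
    then show "u - l \<le> 1 - 1 / (real R + 1)" using N by (simp add: N_def field_simps)
  qed
qed

text \<open>Each side is longer than \<open>\<epsilon>\<close>, since the other factors of the
  volume are at most 1; hence \<open>grid_interval\<close> applies to every side. Each restricted
  side contributes a factor of at most \<open>exp (- 1 / (R + 1))\<close> to the volume, which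
  bounds their number, and \<open>prod_affine_ge\<close> gives the density.\<close>

lemma large_box_contains_grid_box:
  fixes l u :: "'d::finite \<Rightarrow> real" and R A :: nat
  assumes lu: "\<And>i. 0 \<le> l i" "\<And>i. l i \<le> u i" "\<And>i. u i \<le> 1"
    and vol: "\<epsilon> < (\<Prod>i\<in>UNIV. u i - l i)"
    and \<epsilon>: "0 < \<epsilon>" and R: "2 / \<epsilon> \<le> real R"
    and A: "(real R + 1) * ln (inverse \<epsilon>) < real A + 1"
  obtains S where "S \<in> sparse_boxes R A" and "\<epsilon> / 2 * real (R ^ CARD('d)) \<le> real (card S)"
    and "\<And>f i. f \<in> S \<Longrightarrow> l i < real (f i) / (real R + 1) \<and> real (f i) / (real R + 1) < u i"
proof -
  define N where "N = real R + 1"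
  have R0: "real R > 0" using R \<epsilon> by (smt (verit) divide_pos_pos)
  have N: "N > 0" by (simp add: N_def)
  define w where "w i = u i - l i" for i
  have w: "0 \<le> w i" "w i \<le> 1" for i using lu[of i] by (auto simp: w_def)
  have "\<epsilon> < w i" for i
  proof -
    have "(\<Prod>i\<in>UNIV. w i) = w i * (\<Prod>i\<in>UNIV - {i}. w i)" by (simp add: prod.remove)
    also have "\<dots> \<le> w i * 1" using w by (intro mult_left_mono prod_le_1) auto
    finally show ?thesis using vol by (simp add: w_def)
  qed
  moreover have \<epsilon>R: "2 \<le> \<epsilon> * real R" using R \<epsilon> by (simp add: pos_divide_le_eq mult.commute)
  ultimately have Nw: "1 < N * w i" for i
    using mult_strict_left_mono[of \<epsilon> "w i" N] N \<epsilon> by (simp add: N_def algebra_simps)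
  have "\<exists>a b. a \<in> {1..R} \<and> b \<in> {1..R} \<and>
     (\<forall>j\<in>{a..b}. l i < real j / N \<and> real j / N < u i) \<and> N * w i - 1 \<le> real (Suc b - a) \<and>
     (a \<noteq> 1 \<or> b \<noteq> R \<longrightarrow> w i \<le> 1 - 1 / N)" for i
    using grid_interval[OF lu(1)[of i] lu(3)[of i] Nw[of i, unfolded w_def N_def]]
    unfolding w_def N_def by metis
  then obtain a b where ab: "\<And>i. a i \<in> {1..R}" "\<And>i. b i \<in> {1..R}"
      "\<And>i j. j \<in> {a i..b i} \<Longrightarrow> l i < real j / N \<and> real j / N < u i"
      "\<And>i. N * w i - 1 \<le> real (Suc (b i) - a i)"
      "\<And>i. a i \<noteq> 1 \<or> b i \<noteq> R \<Longrightarrow> w i \<le> 1 - 1 / N"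
    by metis
  define T where "T = {i. a i \<noteq> 1 \<or> b i \<noteq> R}"
  have "\<epsilon> < (\<Prod>i\<in>UNIV. w i)" using vol by (simp add: w_def)
  also have "\<dots> \<le> (\<Prod>i\<in>UNIV. if i \<in> T then exp (- 1 / N) else 1)"
  proof (intro prod_mono conjI w)
    fix i
    have "1 - 1 / N \<le> exp (- 1 / N)" using exp_ge_add_one_self[of "- 1 / N"] by simp
    then show "w i \<le> (if i \<in> T then exp (- 1 / N) else 1)"
      using ab(5)[of i] w(2)[of i] by (auto simp: T_def)
  qed
  also have "\<dots> = exp (- 1 / N) ^ card T" by (simp flip: prod.inter_restrict)
  also have "\<dots> = exp (- (real (card T) / N))" by (simp flip: exp_of_nat_mult)
  finally have "ln \<epsilon> < - (real (card T) / N)"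
    using \<epsilon> ln_less_cancel_iff[of \<epsilon> "exp (- (real (card T) / N))"] by simp
  then have "real (card T) < N * ln (inverse \<epsilon>)"
    unfolding ln_inverse using N by (simp add: field_simps)
  then have "card T \<le> A" using A by (simp add: N_def)
  then have S1: "index_box a b \<in> sparse_boxes R A"
    using ab(1,2) unfolding sparse_boxes_def T_def by blast
  have g: "(1 + 1 / real R) * t - 1 / real R = (N * t - 1) / real R" for t
    using R0 by (simp add: N_def field_simps)
  \<comment> \<open>Here \<open>2 / \<epsilon> \<le> R\<close> pays off: half of
    \<open>\<epsilon> * R\<close> is at least 1 and absorbs the subtracted 1.\<close>
  have "\<epsilon> / 2 \<le> (N * \<epsilon> - 1) / real R"
    using \<epsilon>R R0 \<epsilon> by (simp add: pos_le_divide_eq N_def algebra_simps)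
  also have "\<dots> \<le> (N * (\<Prod>i\<in>UNIV. w i) - 1) / real R"
    using vol N R0 by (intro divide_right_mono) (auto simp: w_def)
  also have "\<dots> \<le> (\<Prod>i\<in>UNIV. (N * w i - 1) / real R)"
  proof -
    have "1 / real R \<le> (1 + 1 / real R) * w i" for i
      using Nw[of i] R0 by (simp add: N_def field_simps)
    then show ?thesis
      using prod_affine_ge[of "UNIV :: 'd set" "1 / real R" w] w R0 by (simp only: g) simp
  qed
  also have "\<dots> \<le> (\<Prod>i\<in>UNIV. real (Suc (b i) - a i) / real R)"
    using ab(4) Nw R0 by (intro prod_mono conjI divide_right_mono divide_nonneg_nonneg)
      (auto simp: less_imp_le)
  also have "\<dots> = real (card (index_box a b)) / real (R ^ CARD('d))"
    by (simp add: card_index_box prod_dividef)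
  finally have S2: "\<epsilon> / 2 * real (R ^ CARD('d)) \<le> real (card (index_box a b))"
    using R0 by (simp add: pos_le_divide_eq)
  show ?thesis
    by (rule that[OF S1 S2]) (use ab(3) in \<open>auto simp: mem_index_box N_def\<close>)
qed

section \<open>Reduction of the dispersion to open boxes\<close>

text \<open>The infima and suprema of the sides span an open box whose volume is at least that of
  \<open>B\<close>. A point strictly between the infimum and supremum of an interval belongs to it,
  so a point of \<open>P\<close> in the open box lies in \<open>B\<close>, whatever the kind of its
  sides.\<close>

lemma disp_le:
  fixes P :: "(real ^ 'd::finite) set"
  assumes "\<epsilon> \<ge> 0"
    and "\<And>l u. (\<And>i. 0 \<le> l i \<and> l i \<le> u i \<and> u i \<le> 1) \<Longrightarrow> \<epsilon> < (\<Prod>i\<in>UNIV. u i - l i) \<Longrightarrow>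
      \<exists>x\<in>P. \<forall>i. l i < x $ i \<and> x $ i < u i"
  shows "disp P \<le> \<epsilon>"
  unfolding disp_def
proof (rule cSUP_least)
  have "unit_box ({} :: (real ^ 'd) set)"
    unfolding unit_box_def by (rule exI[of _ "\<lambda>_. {}"]) auto
  then show "{B. unit_box B \<and> B \<inter> P = {}} \<noteq> {}" by blast
next
  fix B assume "B \<in> {B. unit_box B \<and> B \<inter> P = {}}"
  then have "unit_box B" and BP: "B \<inter> P = {}" by simp_all
  then obtain I where "\<forall>i. is_interval (I i) \<and> I i \<subseteq> {0..1}" and "B = {x. \<forall>i. x $ i \<in> I i}"
    unfolding unit_box_def by (elim exE conjE)
  then have I: "\<And>i. is_interval (I i)" "\<And>i. I i \<subseteq> {0..1}" "B = {x. \<forall>i. x $ i \<in> I i}"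
    by simp_all
  show "measure lebesgue B \<le> \<epsilon>"
  proof (rule ccontr)
    assume "\<not> ?thesis"
    then have big: "\<epsilon> < measure lebesgue B" by simp
    have ne: "I i \<noteq> {}" for i
    proof
      assume "I i = {}"
      then have "B = {}" using I(3) by auto
      then show False using big assms(1) by simp
    qed
    define l u where "l i = Inf (I i)" and "u i = Sup (I i)" for i
    have "\<epsilon> < (\<Prod>i\<in>UNIV. u i - l i)"
      using big measure_box_le[of I, OF ne I(2)] by (simp add: I(3) l_def u_def)
    moreover have "0 \<le> l i \<and> l i \<le> u i \<and> u i \<le> 1" for i
    proof (intro conjI)
      show "0 \<le> l i" "u i \<le> 1" unfolding l_def u_def
        using I(2)[of i] ne[of i]
        by (auto intro!: cInf_greatest cSup_least)
      have "bdd_below (I i)" "bdd_above (I i)"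
        using I(2)[of i] by (meson bdd_below_Icc bdd_below_mono, meson bdd_above_Icc bdd_above_mono)
      then show "l i \<le> u i" unfolding l_def u_def using ne[of i] by (intro cInf_le_cSup)
    qed
    ultimately obtain x where x: "x \<in> P" "\<And>i. l i < x $ i \<and> x $ i < u i"
      using assms(2) by blast
    have "x $ i \<in> I i" for i
    proof -
      obtain y z where "y \<in> I i" "y < x $ i" "z \<in> I i" "x $ i < z"
        using x(2)[of i] cInf_lessD[OF ne[of i]] less_cSupD[OF ne[of i]] unfolding l_def u_def
        by blast
      then show ?thesis using I(1)[of i] unfolding is_interval_1 by (meson less_imp_le)
    qed
    then show False using x(1) BP I(3) by blast
  qed
qed

section \<open>Choice of parameters and the final bound\<close>

theorem theorem1:
  fixes \<epsilon> :: real
  assumes "CARD('d::finite) \<ge> 2" and "\<epsilon> \<in> {0<..<1/2}"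
  shows "\<exists>P :: (real ^ 'd) set. finite P \<and> P \<subseteq> unit_cube \<and> disp P \<le> \<epsilon> \<and>
           real (card P) \<le> 2 ^ 7 * log 2 (real CARD('d)) * ((1 + log 2 (inverse \<epsilon>))\<^sup>2 / \<epsilon>\<^sup>2)"
proof -
  have \<epsilon>: "0 < \<epsilon>" "\<epsilon> < 1 / 2" using assms by auto
  define R where "R = nat \<lceil>2 / \<epsilon>\<rceil>"
  define A where "A = nat \<lfloor>(real R + 1) * ln (inverse \<epsilon>)\<rfloor>"
  define L where "L = log 2 (inverse \<epsilon>)"
  define D where "D = log 2 (real CARD('d))"
  \<comment> \<open>The least integer strictly above \<open>(2 / \<epsilon>) * A * ln K\<close>,
    because \<open>hitting_set\<close> asks for a strict inequality.\<close>
  define n where "n = nat \<lfloor>real A * ln (real (CARD('d) * (R * R))) / (\<epsilon> / 2)\<rfloor> + 1"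
  define K where "K = real (CARD('d) * (R * R))"
  have inv: "1 / \<epsilon> > 2" using \<epsilon> by (simp add: field_simps)
  have R: "2 / \<epsilon> \<le> real R" by (simp add: R_def real_nat_ceiling_ge)
  have "real R \<le> 2 / \<epsilon> + 1" using \<epsilon> unfolding R_def by (simp add: of_nat_nat)
  then have R4: "real R + 1 \<le> 4 / \<epsilon>" using inv by simp
  have R0: "real R > 0" using R inv by linarith
  \<comment> \<open>The exponential estimates produce natural logarithms; this passes to the binary
    ones of the claim, using \<open>ln 2 < 1\<close>.\<close>
  have lnle: "ln x \<le> log 2 x" if "x \<ge> 1" for x :: real
    using that ln_2_less_1 ln_ge_zero[OF that] by (simp add: log_def pos_le_divide_eq mult_left_le)
  have inv1: "inverse \<epsilon> \<ge> 2" using inv by (simp add: inverse_eq_divide)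
  have L: "L \<ge> 1" unfolding L_def using inv1 \<epsilon> by (subst one_le_log_cancel_iff) auto
  have D: "D \<ge> 1" unfolding D_def using assms(1) by (subst one_le_log_cancel_iff) auto
  have ln0: "0 \<le> ln (inverse \<epsilon>)" using inv1 by (intro ln_ge_zero) linarith
  then have A0: "0 \<le> (real R + 1) * ln (inverse \<epsilon>)" by simp
  then have A: "real A \<le> (real R + 1) * ln (inverse \<epsilon>)" "(real R + 1) * ln (inverse \<epsilon>) < real A + 1"
    unfolding A_def by linarith+
  have AL: "real A \<le> (4 / \<epsilon>) * L"
  proof -
    have "ln (inverse \<epsilon>) \<le> L" unfolding L_def using inv1 by (intro lnle) linarith
    then have "(real R + 1) * ln (inverse \<epsilon>) \<le> (4 / \<epsilon>) * L"
      using R4 ln0 \<epsilon> by (intro mult_mono) auto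
    with A(1) show ?thesis by (rule order_trans)
  qed
  have K1: "K \<ge> 1"
  proof -
    have "1 \<le> CARD('d) * (R * R)" using assms(1) R0 by (simp add: Suc_le_eq)
    then show ?thesis unfolding K_def by linarith
  qed
  have "real R * real R \<le> (4 / \<epsilon>) * (4 / \<epsilon>)" using R4 R0 \<epsilon> by (intro mult_mono) auto
  then have "K \<le> real CARD('d) * ((4 / \<epsilon>) * (4 / \<epsilon>))"
    unfolding K_def of_nat_mult by (rule mult_left_mono) simp
  then have "log 2 K \<le> log 2 (real CARD('d) * ((4 / \<epsilon>) * (4 / \<epsilon>)))"
    using K1 by (subst log_le_cancel_iff) auto
  also have "\<dots> = D + 2 * (2 + L)"
    using \<epsilon> assms(1) log_pow_cancel[of 2 4]
    by (simp add: log_mult log_divide log_inverse D_def L_def)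
  finally have lnK: "ln K \<le> D + 2 * (2 + L)" using lnle[OF K1] by simp
  have "real A * ln K \<le> (4 / \<epsilon>) * L * (D + 2 * (2 + L))"
    using AL lnK K1 \<epsilon> L by (intro mult_mono) auto
  then have "real A * ln K / (\<epsilon> / 2) \<le> (4 / \<epsilon>) * L * (D + 2 * (2 + L)) / (\<epsilon> / 2)"
    using \<epsilon> by (intro divide_right_mono) auto
  also have "\<dots> = 8 * (L * (D + 2 * (2 + L))) / \<epsilon>\<^sup>2"
    using \<epsilon> by (simp add: field_simps power2_eq_square)
  \<comment> \<open>\<open>D \<ge> 1\<close> turns the sum into a product with factor
    \<open>D\<close>, and \<open>L * (5 + 2 * L)\<close> is then compared with
    \<open>3 * (1 + L)\<^sup>2\<close> coefficient by coefficient.\<close>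
  also have "\<dots> \<le> 8 * (D * (3 * (1 + L)\<^sup>2)) / \<epsilon>\<^sup>2"
  proof -
    have "D + 2 * (2 + L) \<le> D * (5 + 2 * L)"
      using mult_right_mono[OF D, of "4 + 2 * L"] L by (simp add: algebra_simps)
    then have "L * (D + 2 * (2 + L)) \<le> L * (D * (5 + 2 * L))" using L by (intro mult_left_mono) auto
    also have "\<dots> = D * (L * (5 + 2 * L))" by simp
    also have "\<dots> \<le> D * (3 * (1 + L)\<^sup>2)"
    proof (rule mult_left_mono)
      have "0 \<le> L * L" by simp
      then show "L * (5 + 2 * L) \<le> 3 * (1 + L)\<^sup>2" using L by (simp add: power2_eq_square algebra_simps)
    qed (use D in simp)
    finally show ?thesis by (intro divide_right_mono) auto
  qed
  also have "\<dots> = 24 * (D * ((1 + L)\<^sup>2 / \<epsilon>\<^sup>2))" by simp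
  finally have n1: "real A * ln K / (\<epsilon> / 2) \<le> 24 * (D * ((1 + L)\<^sup>2 / \<epsilon>\<^sup>2))" .
  \<comment> \<open>This absorbs the extra 1 from rounding in \<open>n\<close>, so the constant
    becomes 25, well below \<open>2 ^ 7\<close>.\<close>
  have one: "1 \<le> D * ((1 + L)\<^sup>2 / \<epsilon>\<^sup>2)"
  proof -
    have "\<epsilon>\<^sup>2 \<le> 1" "1 \<le> (1 + L)\<^sup>2" using \<epsilon> L by (auto intro: power_le_one one_le_power)
    then have "1 \<le> (1 + L)\<^sup>2 / \<epsilon>\<^sup>2" using \<epsilon> by (simp add: pos_le_divide_eq)
    then show ?thesis using D mult_mono[of 1 D 1] by fastforce
  qed
  have q0: "0 \<le> real A * ln K / (\<epsilon> / 2)" using K1 \<epsilon> by simp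
  then have "real n \<le> real A * ln K / (\<epsilon> / 2) + 1" and n2: "real A * ln K / (\<epsilon> / 2) < real n"
    unfolding n_def K_def[symmetric] by (simp_all add: of_nat_nat) linarith
  then have n_le: "real n \<le> 2 ^ 7 * D * ((1 + L)\<^sup>2 / \<epsilon>\<^sup>2)" using n1 one by simp

  \<comment> \<open>Hitting all dense sparse boxes with \<open>n\<close> grid points\<close>
  define X where "X = index_box (\<lambda>_ :: 'd. 1) (\<lambda>_. R)"
  \<comment> \<open>Only boxes dense enough for the greedy argument are kept; the count of all
    sparse boxes still bounds their number.\<close>
  define F :: "('d \<Rightarrow> nat) set set"
    where "F = {S \<in> sparse_boxes R A. \<epsilon> / 2 * real (card X) \<le> real (card S)}"
  have cX: "card X = R ^ CARD('d)" by (simp add: X_def card_index_box)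
  then have X: "finite X" "X \<noteq> {}" using R0 by (auto intro: card_ge_0_finite)
  have FX: "S \<subseteq> X" if "S \<in> F" for S
    using that sparse_box_subset by (auto simp: F_def X_def)
  have "card F \<le> card (sparse_boxes R A :: ('d \<Rightarrow> nat) set set)"
    unfolding F_def by (intro card_mono sparse_boxes_bound) auto
  also have "\<dots> \<le> (CARD('d) * (R * R)) ^ A" by (rule sparse_boxes_bound)
  finally have "real (card F) \<le> K ^ A" unfolding K_def of_nat_power[symmetric] of_nat_le_iff .
  also have "K ^ A = exp (real A * ln K)" using K1 by (simp add: exp_of_nat_mult)
  also have "\<dots> < exp (\<epsilon> / 2 * real n)" using n2 \<epsilon> by (simp add: field_simps)
  finally have cF: "real (card F) < exp (\<epsilon> / 2 * real n)" .
  have "\<exists>Q\<subseteq>X. card Q \<le> n \<and> (\<forall>S\<in>F. S \<inter> Q \<noteq> {})"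
  proof (rule hitting_set[OF X(1) _ X(2) _ FX _ cF])
    show "finite F" unfolding F_def by (rule finite_subset[OF _ sparse_boxes_bound(1)[of R A]]) blast
    show "\<epsilon> / 2 \<le> 1" using \<epsilon> by simp
    show "\<epsilon> / 2 * real (card X) \<le> real (card S)" if "S \<in> F" for S
      using that unfolding F_def by blast
  qed
  then obtain Q where Q: "Q \<subseteq> X" "card Q \<le> n" "\<And>S. S \<in> F \<Longrightarrow> S \<inter> Q \<noteq> {}"
    by blast
  define pt where "pt f = (\<chi> i. real (f i) / (real R + 1))" for f :: "'d \<Rightarrow> nat"
  have finQ: "finite Q" using Q(1) X(1) by (rule finite_subset)
  have "disp (pt ` Q) \<le> \<epsilon>"
  proof (rule disp_le)
    fix l u :: "'d \<Rightarrow> real"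
    assume lu: "\<And>i. 0 \<le> l i \<and> l i \<le> u i \<and> u i \<le> 1" and vol: "\<epsilon> < (\<Prod>i\<in>UNIV. u i - l i)"
    obtain S where S: "S \<in> sparse_boxes R A" "\<epsilon> / 2 * real (R ^ CARD('d)) \<le> real (card S)"
      "\<And>f i. f \<in> S \<Longrightarrow> l i < real (f i) / (real R + 1) \<and> real (f i) / (real R + 1) < u i"
      by (rule large_box_contains_grid_box[OF _ _ _ vol \<epsilon>(1) R A(2)]) (use lu in blast)+
    have "S \<in> F" using S(1,2) unfolding F_def cX by blast
    then obtain f where "f \<in> S" "f \<in> Q" using Q(3) by blast
    then show "\<exists>x\<in>pt ` Q. \<forall>i. l i < x $ i \<and> x $ i < u i"
      using S(3) by (auto simp: pt_def)
  qed (use \<epsilon> in simp)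
  moreover have "pt ` Q \<subseteq> unit_cube"
  proof -
    have "real (f i) / (real R + 1) \<le> 1" if "f \<in> Q" for f i
    proof -
      have "f i \<le> R" using that Q(1) by (auto simp: X_def mem_index_box)
      then show ?thesis by (simp add: divide_le_eq_1)
    qed
    then show ?thesis by (auto simp: unit_cube_def pt_def)
  qed
  moreover have "real (card (pt ` Q)) \<le> real n"
    using card_image_le[OF finQ, of pt] Q(2) by simp
  ultimately show ?thesis
    using finQ n_le unfolding D_def L_def by (intro exI[of _ "pt ` Q"]) auto
qed

end
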